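(* Let $(E,\pi,B)$ be a complex vector bundle with fibres of complex dimension $n$, $g$ a Hermitian bundle metric and $L$ a ($\mathbb{C}$-)linear transport along paths in it. For each path $\gamma:J\to B$ fix bases of the fibres $\pi^{-1}(\gamma(s))$, $s\in J$, and let $H(t,s;\gamma)$ and $G(\gamma(s))$ be the matrices of $L$ and $g$ in them. Then $g$ and $L$ are consistent (resp. consistent along a given path $\gamma$) if and only if $$G^{T}(\gamma(s))=H^{*}(t,s;\gamma)\,G^{T}(\gamma(t))\,H(t,s;\gamma),\qquad s,t\in J,$$ for every (resp. for the given) path $\gamma:J\to B$.
   Context: A path in $B$ is a (continuous) map $\gamma:J\to B$ with $J$ an arbitrary real interval. A Hermitian bundle metric $g$ assigns to each $x\in B$ a map $g_x:\pi^{-1}(x)\times\pi^{-1}(x)\to\mathbb{C}$ that is sesquilinear (linear in the first and conjugate-linear in the second argument), nondegenerate, and Hermitian, $g_x(u,v)=\overline{g_x(v,u)}$. Positive definiteness and regularity in $x$ are not assumed. A linear transport along paths $L$ assigns to each path $\gamma:J\to B$ and $s,t\in J$ a $\mathbb{C}$-linear map $L^\gamma_{s\to t}:\pi^{-1}(\gamma(s))\to\pi^{-1}(\gamma(t))$ with $L^\gamma_{t\to r}\circ L^\gamma_{s\to t}=L^\gamma_{s\to r}$ and $L^\gamma_{s\to s}=\mathrm{id}$ for all $r,s,t\in J$. $L$ and $g$ are consistent along $\gamma$ if $g_{\gamma(s)}(u,v)=g_{\gamma(t)}(L^\gamma_{s\to t}u,L^\gamma_{s\to t}v)$ for all $s,t\in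 J$, $u,v\in\pi^{-1}(\gamma(s))$; they are (globally) consistent if this holds along every path. In bases $\{e_i(s)\}$: $L^\gamma_{s\to t}e_j(s)=\sum_iH^{i}_{\;j}(t,s;\gamma)e_i(t)$, and $G(\gamma(s))=[g_{\gamma(s)}(e_i(s),e_j(s))]_{ij}$. $T$ is transposition and $*$ is Hermitian conjugation (conjugate transpose) of matrices. *)

theory Defs
  imports "HOL-Analysis.Analysis" "Jordan_Normal_Form.Schur_Decomposition"
begin

text \<open>
  A bundle has total space \<open>E\<close>, projection \<open>p\<close> and base \<open>B\<close>; the linear structure of
  the fibre over \<open>x\<close> is the record \<open>F x\<close>, whose carrier is the set of points of \<open>E\<close> over \<open>x\<close>.
  The trivializations take values in \<open>U \<times> \<complex>\<^sup>n\<close>, where \<open>\<complex>\<^sup>n\<close> is the product topology on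
  functions on \<open>{..<n}\<close>; for linearity such a function is read as a vector via \<^const>\<open>vec\<close>.
\<close>

locale complex_vector_bundle =
  fixes E :: "'e topology" and p :: "'e \<Rightarrow> 'b" and B :: "'b topology"
    and F :: "'b \<Rightarrow> (complex, 'e) module" and n :: nat
  assumes projection: "continuous_map E B p"
    and fibre_carrier: "\<And>x. x \<in> topspace B \<Longrightarrow> carrier (F x) = {v \<in> topspace E. p v = x}"
    and fibre_vectorspace: "\<And>x. x \<in> topspace B \<Longrightarrow> vectorspace class_ring (F x)"
    and fibre_fin_dim: "\<And>x. x \<in> topspace B \<Longrightarrow> vectorspace.fin_dim class_ring (F x)"
    and fibre_dim: "\<And>x. x \<in> topspace B \<Longrightarrow> vectorspace.dim class_ring (F x) = n"
    and locally_trivial: "\<And>x. x \<in> topspace B \<Longrightarrow>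
      \<exists>U \<phi>. openin B U \<and> x \<in> U \<and>
        homeomorphic_map (subtopology E {v \<in> topspace E. p v \<in> U})
          (prod_topology (subtopology B U) (product_topology (\<lambda>_. euclidean :: complex topology) {..<n}))
          \<phi> \<and>
        (\<forall>v \<in> topspace E. p v \<in> U \<longrightarrow> fst (\<phi> v) = p v) \<and>
        (\<forall>y \<in> U. linear_map class_ring (F y) (module_vec TYPE(complex) n) (\<lambda>v. vec n (snd (\<phi> v))))"

text \<open>
  A path is given by its interval \<open>J\<close> (of any kind, possibly degenerate) together with a map on
  \<open>J\<close>. The map is required to be extensional so that anything depending on a path depends only
  on \<open>J\<close> and the values of the map on \<open>J\<close>.
\<close>

definition is_path :: "'b topology \<Rightarrow> real set \<Rightarrow> (real \<Rightarrow> 'b) \<Rightarrow> bool" where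
  "is_path B J \<gamma> \<longleftrightarrow>
     is_interval J \<and> \<gamma> \<in> extensional J \<and> continuous_map (top_of_set J) B \<gamma>"

definition nondegenerate_hermitian_form ::
    "(complex, 'e) module \<Rightarrow> ('e \<Rightarrow> 'e \<Rightarrow> complex) \<Rightarrow> bool" where
  "nondegenerate_hermitian_form V h \<longleftrightarrow>
     (\<forall>u\<in>carrier V. \<forall>v\<in>carrier V. \<forall>w\<in>carrier V. h (u \<oplus>\<^bsub>V\<^esub> v) w = h u w + h v w) \<and>
     (\<forall>c. \<forall>u\<in>carrier V. \<forall>w\<in>carrier V. h (c \<odot>\<^bsub>V\<^esub> u) w = c * h u w) \<and>
     (\<forall>u\<in>carrier V. \<forall>v\<in>carrier V. \<forall>w\<in>carrier V. h u (v \<oplus>\<^bsub>V\<^esub> w) = h u v + h u w) \<and>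
     (\<forall>c. \<forall>u\<in>carrier V. \<forall>w\<in>carrier V. h u (c \<odot>\<^bsub>V\<^esub> w) = cnj c * h u w) \<and>
     (\<forall>u\<in>carrier V. (\<forall>v\<in>carrier V. h u v = 0) \<longrightarrow> u = \<zero>\<^bsub>V\<^esub>) \<and>
     (\<forall>v\<in>carrier V. (\<forall>u\<in>carrier V. h u v = 0) \<longrightarrow> v = \<zero>\<^bsub>V\<^esub>) \<and>
     (\<forall>u\<in>carrier V. \<forall>v\<in>carrier V. h u v = cnj (h v u))"

definition hermitian_bundle_metric ::
    "'b topology \<Rightarrow> ('b \<Rightarrow> (complex, 'e) module) \<Rightarrow> ('b \<Rightarrow> 'e \<Rightarrow> 'e \<Rightarrow> complex) \<Rightarrow> bool" where
  "hermitian_bundle_metric B F g \<longleftrightarrow>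
     (\<forall>x\<in>topspace B. nondegenerate_hermitian_form (F x) (g x))"

text \<open>\<open>L J \<gamma> s t\<close> is the transport \<open>L\<^sup>\<gamma>\<close> from \<open>s\<close> to \<open>t\<close> along \<open>\<gamma>\<close> on \<open>J\<close>.\<close>

definition linear_transport ::
    "'b topology \<Rightarrow> ('b \<Rightarrow> (complex, 'e) module) \<Rightarrow>
     (real set \<Rightarrow> (real \<Rightarrow> 'b) \<Rightarrow> real \<Rightarrow> real \<Rightarrow> 'e \<Rightarrow> 'e) \<Rightarrow> bool" where
  "linear_transport B F L \<longleftrightarrow>
     (\<forall>J \<gamma>. is_path B J \<gamma> \<longrightarrow>
        (\<forall>s\<in>J. \<forall>t\<in>J. linear_map class_ring (F (\<gamma> s)) (F (\<gamma> t)) (L J \<gamma> s t)) \<and>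
        (\<forall>r\<in>J. \<forall>s\<in>J. \<forall>t\<in>J. \<forall>v\<in>carrier (F (\<gamma> s)).
           L J \<gamma> t r (L J \<gamma> s t v) = L J \<gamma> s r v) \<and>
        (\<forall>s\<in>J. \<forall>v\<in>carrier (F (\<gamma> s)). L J \<gamma> s s v = v))"

definition consistent_along ::
    "('b \<Rightarrow> (complex, 'e) module) \<Rightarrow> ('b \<Rightarrow> 'e \<Rightarrow> 'e \<Rightarrow> complex) \<Rightarrow>
     (real set \<Rightarrow> (real \<Rightarrow> 'b) \<Rightarrow> real \<Rightarrow> real \<Rightarrow> 'e \<Rightarrow> 'e) \<Rightarrow>
     real set \<Rightarrow> (real \<Rightarrow> 'b) \<Rightarrow> bool" where
  "consistent_along F g L J \<gamma> \<longleftrightarrow>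
     (\<forall>s\<in>J. \<forall>t\<in>J. \<forall>u\<in>carrier (F (\<gamma> s)). \<forall>v\<in>carrier (F (\<gamma> s)).
        g (\<gamma> s) u v = g (\<gamma> t) (L J \<gamma> s t u) (L J \<gamma> s t v))"

definition consistent ::
    "'b topology \<Rightarrow> ('b \<Rightarrow> (complex, 'e) module) \<Rightarrow> ('b \<Rightarrow> 'e \<Rightarrow> 'e \<Rightarrow> complex) \<Rightarrow>
     (real set \<Rightarrow> (real \<Rightarrow> 'b) \<Rightarrow> real \<Rightarrow> real \<Rightarrow> 'e \<Rightarrow> 'e) \<Rightarrow> bool" where
  "consistent B F g L \<longleftrightarrow> (\<forall>J \<gamma>. is_path B J \<gamma> \<longrightarrow> consistent_along F g L J \<gamma>)"

definition indexed_basis :: "(complex, 'e) module \<Rightarrow> nat \<Rightarrow> (nat \<Rightarrow> 'e) \<Rightarrow> bool" where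
  "indexed_basis V n b \<longleftrightarrow>
     inj_on b {..<n} \<and> vectorspace.basis class_ring V (b ` {..<n})"

text \<open>The matrix of \<open>T\<close> into \<open>W\<close>, with \<open>b\<close> the basis of the source and \<open>c\<close> that of \<open>W\<close>:
  column \<open>j\<close> holds the coordinates of \<open>T (b j)\<close>.\<close>

definition map_matrix ::
    "nat \<Rightarrow> (complex, 'e) module \<Rightarrow> (nat \<Rightarrow> 'e) \<Rightarrow> (nat \<Rightarrow> 'e) \<Rightarrow> ('e \<Rightarrow> 'e) \<Rightarrow> complex mat" where
  "map_matrix n W b c T =
     (THE M. M \<in> carrier_mat n n \<and>
        (\<forall>j<n. T (b j) = (\<Oplus>\<^bsub>W\<^esub> i\<in>{..<n}. M $$ (i, j) \<odot>\<^bsub>W\<^esub> c i)))"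

text \<open>In the next two definitions \<open>e s\<close> is the basis of the fibre over \<open>\<gamma> s\<close>. It is indexed by the
  parameter, so that at a self-intersection of \<open>\<gamma>\<close> the bases may differ; hence \<open>G(\<gamma>(s))\<close>
  also takes \<open>s\<close> rather than just the point \<open>\<gamma> s\<close>. The arguments of
  \<open>transport_matrix\<close> after \<open>\<gamma>\<close> are in the order \<open>t s\<close> of \<open>H(t,s;\<gamma>)\<close>.\<close>

definition transport_matrix ::
    "nat \<Rightarrow> ('b \<Rightarrow> (complex, 'e) module) \<Rightarrow>
     (real set \<Rightarrow> (real \<Rightarrow> 'b) \<Rightarrow> real \<Rightarrow> real \<Rightarrow> 'e \<Rightarrow> 'e) \<Rightarrow> (real \<Rightarrow> nat \<Rightarrow> 'e) \<Rightarrow>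
     real set \<Rightarrow> (real \<Rightarrow> 'b) \<Rightarrow> real \<Rightarrow> real \<Rightarrow> complex mat" where
  "transport_matrix n F L e J \<gamma> t s = map_matrix n (F (\<gamma> t)) (e s) (e t) (L J \<gamma> s t)"

definition metric_matrix ::
    "nat \<Rightarrow> ('b \<Rightarrow> 'e \<Rightarrow> 'e \<Rightarrow> complex) \<Rightarrow> (real \<Rightarrow> nat \<Rightarrow> 'e) \<Rightarrow> (real \<Rightarrow> 'b) \<Rightarrow> real \<Rightarrow>
     complex mat" where
  "metric_matrix n g e \<gamma> s = mat n n (\<lambda>(i, j). g (\<gamma> s) (e s i) (e s j))"

end

theory Submission
  imports Defs
begin

text \<open>Fix a path and parameters s, t. Consistency says that the linear map from the fibre at s
  to the fibre at t pulls the form at t back to the form at s. The form at s and the pulled-back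
  form are both sesquilinear, so they agree everywhere as soon as they agree on pairs of basis
  vectors. Expanding the images of the basis vectors through the columns of H gives g(L e_i, L e_j)
  = sum over k, l of H_ki cnj(H_lj) G_kl, which is the (j, i) entry of H^* G^T H; the transpose
  appears because the form is conjugate-linear in its second argument. Comparing with the (j, i)
  entry of G^T, which is g(e_i, e_j), gives the matrix equation.

  The equivalence for a single linear map between two spaces with forms is
  \<open>isometry_iff_matrix\<close>. It rests on the sesquilinear expansion
  \<open>form_finsum\<close>, on the entry formula \<open>index_adjoint_mult_transpose_mult\<close>,
  and on \<open>map_matrix_ex1\<close>, which makes the definite description in
  \<open>map_matrix\<close> meaningful. Quantifying over s and t gives consistency along one path,
  and quantifying over paths gives global consistency.\<close>

lemma ex1_unique:
  assumes "\<exists>!x. P x" and "P x" and "P y"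
  shows "x = y"
  using assms by blast

section \<open>Coordinates with respect to an indexed basis\<close>

lemma indexed_basis_closed:
  assumes "vectorspace class_ring V" and "indexed_basis V n b" and "i < n"
  shows "b i \<in> carrier V"
proof -
  interpret V: vectorspace class_ring V by fact
  show ?thesis
    using assms(2,3) by (auto simp: indexed_basis_def V.basis_def)
qed

text \<open>The library's \<open>lincomb\<close> attaches coefficients to the vectors of a set.
  Injectivity of \<open>b\<close> allows the sum to be reindexed by numbers.\<close>

lemma lincomb_indexed_basis:
  assumes "vectorspace class_ring V" and "indexed_basis V n b"
  shows "module.lincomb V a (b ` {..<n}) = (\<Oplus>\<^bsub>V\<^esub> i\<in>{..<n}. a (b i) \<odot>\<^bsub>V\<^esub> b i)"
proof -
  interpret V: vectorspace class_ring V by fact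
  show ?thesis
    unfolding V.lincomb_def
  proof (rule V.finsum_reindex)
    show "(\<lambda>v. a v \<odot>\<^bsub>V\<^esub> v) \<in> b ` {..<n} \<rightarrow> carrier V"
      using indexed_basis_closed[OF assms] by auto
    show "inj_on b {..<n}"
      using assms(2) by (simp add: indexed_basis_def)
  qed
qed

text \<open>Translates the library's basis criterion from sets of vectors to indexed families.
  Extensionality is what makes uniqueness possible: the sum does not see the values of
  \<open>a\<close> outside \<open>{..<n}\<close>.\<close>

lemma indexed_basis_ex1_coords:
  fixes V :: "(complex, 'e) module"
  assumes "vectorspace class_ring V" and "indexed_basis V n b" and "v \<in> carrier V"
  shows "\<exists>!a. a \<in> extensional {..<n} \<and> v = (\<Oplus>\<^bsub>V\<^esub> i\<in>{..<n}. a i \<odot>\<^bsub>V\<^esub> b i)"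
proof -
  interpret V: vectorspace class_ring V by fact
  let ?A = "b ` {..<n}"
  have inj: "inj_on b {..<n}" and "V.basis ?A" and sub: "?A \<subseteq> carrier V"
    using assms(2) by (auto simp: indexed_basis_def V.basis_def)
  then have ex1: "\<exists>!a. a \<in> ?A \<rightarrow>\<^sub>E UNIV \<and> V.lincomb a ?A = v"
    using V.basis_criterion[of ?A] assms(3) by simp
  show ?thesis
  proof (rule ex_ex1I)
    obtain a where "V.lincomb a ?A = v"
      using ex1 by blast
    then have v: "v = (\<Oplus>\<^bsub>V\<^esub> i\<in>{..<n}. a (b i) \<odot>\<^bsub>V\<^esub> b i)"
      using lincomb_indexed_basis[OF assms(1,2)] by simp
    have "(\<Oplus>\<^bsub>V\<^esub> i\<in>{..<n}. a (b i) \<odot>\<^bsub>V\<^esub> b i) =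
        (\<Oplus>\<^bsub>V\<^esub> i\<in>{..<n}. restrict (a \<circ> b) {..<n} i \<odot>\<^bsub>V\<^esub> b i)"
      by (rule V.finsum_cong') (use indexed_basis_closed[OF assms(1,2)] in auto)
    with v show "\<exists>a. a \<in> extensional {..<n} \<and> v = (\<Oplus>\<^bsub>V\<^esub> i\<in>{..<n}. a i \<odot>\<^bsub>V\<^esub> b i)"
      by (intro exI[of _ "restrict (a \<circ> b) {..<n}"] conjI restrict_extensional) (rule trans)
  next
    fix a a'
    assume a: "a \<in> extensional {..<n} \<and> v = (\<Oplus>\<^bsub>V\<^esub> i\<in>{..<n}. a i \<odot>\<^bsub>V\<^esub> b i)"
      and a': "a' \<in> extensional {..<n} \<and> v = (\<Oplus>\<^bsub>V\<^esub> i\<in>{..<n}. a' i \<odot>\<^bsub>V\<^esub> b i)"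
    \<comment> \<open>\<open>r c\<close> moves index coefficients onto the basis vectors by
      inverting \<open>b\<close>; the restriction puts it into the function space in which the basis
      criterion asserts uniqueness.\<close>
    define r where "r c = restrict (\<lambda>w. c (inv_into {..<n} b w)) ?A" for c :: "nat \<Rightarrow> complex"
    have r: "r c (b i) = c i" if "i < n" for c i
      using that inj by (simp add: r_def)
    have lincomb: "V.lincomb (r c) ?A = (\<Oplus>\<^bsub>V\<^esub> i\<in>{..<n}. c i \<odot>\<^bsub>V\<^esub> b i)" for c
      unfolding lincomb_indexed_basis[OF assms(1,2)]
      by (rule V.finsum_cong') (use indexed_basis_closed[OF assms(1,2)] in \<open>auto simp: r\<close>)
    have rep: "r c \<in> ?A \<rightarrow>\<^sub>E UNIV \<and> V.lincomb (r c) ?A = v"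
      if "v = (\<Oplus>\<^bsub>V\<^esub> i\<in>{..<n}. c i \<odot>\<^bsub>V\<^esub> b i)" for c
      unfolding that lincomb by (simp add: r_def)
    have "r a = r a'"
      using rep[OF conjunct2[OF a]] rep[OF conjunct2[OF a']]
      by (rule ex1_unique[OF ex1, of "r a" "r a'"])
    then have "a i = a' i" if "i < n" for i
      using r[OF that, of a] r[OF that, of a'] by simp
    with a a' show "a = a'"
      by (auto intro: extensionalityI)
  qed
qed

lemma indexed_basis_coords:
  fixes V :: "(complex, 'e) module"
  assumes "vectorspace class_ring V" and "indexed_basis V n b" and "v \<in> carrier V"
  obtains a where "v = (\<Oplus>\<^bsub>V\<^esub> i\<in>{..<n}. a i \<odot>\<^bsub>V\<^esub> b i)"
  using ex1_implies_ex[OF indexed_basis_ex1_coords[OF assms]] that by (elim exE conjE)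

section \<open>The matrix of a linear map\<close>

text \<open>Each column is the coordinate vector of \<open>T (b j)\<close>, so existence and
  uniqueness of coordinates carry over column by column. Only the values of \<open>T\<close> on the
  basis matter here, hence no linearity is assumed.\<close>

lemma map_matrix_ex1:
  fixes W :: "(complex, 'e) module"
  assumes "vectorspace class_ring W" and "indexed_basis W n c"
    and "\<And>j. j < n \<Longrightarrow> T (b j) \<in> carrier W"
  shows "\<exists>!M. M \<in> carrier_mat n n \<and>
    (\<forall>j<n. T (b j) = (\<Oplus>\<^bsub>W\<^esub> i\<in>{..<n}. M $$ (i, j) \<odot>\<^bsub>W\<^esub> c i))"
proof (rule ex_ex1I)
  interpret W: vectorspace class_ring W by fact
  have "\<forall>j<n. \<exists>a. T (b j) = (\<Oplus>\<^bsub>W\<^esub> i\<in>{..<n}. a i \<odot>\<^bsub>W\<^esub> c i)"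
    using indexed_basis_coords[OF assms(1,2)] assms(3) by metis
  then obtain a where a: "\<And>j. j < n \<Longrightarrow> T (b j) = (\<Oplus>\<^bsub>W\<^esub> i\<in>{..<n}. a j i \<odot>\<^bsub>W\<^esub> c i)"
    by metis
  let ?M = "mat n n (\<lambda>(i, j). a j i)"
  have "(\<Oplus>\<^bsub>W\<^esub> i\<in>{..<n}. a j i \<odot>\<^bsub>W\<^esub> c i) = (\<Oplus>\<^bsub>W\<^esub> i\<in>{..<n}. ?M $$ (i, j) \<odot>\<^bsub>W\<^esub> c i)"
    if "j < n" for j
    by (rule W.finsum_cong') (use that indexed_basis_closed[OF assms(1,2)] in auto)
  with a show "\<exists>M. M \<in> carrier_mat n n \<and>
      (\<forall>j<n. T (b j) = (\<Oplus>\<^bsub>W\<^esub> i\<in>{..<n}. M $$ (i, j) \<odot>\<^bsub>W\<^esub> c i))"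
    by (intro exI[of _ ?M]) simp
next
  interpret W: vectorspace class_ring W by fact
  fix M M'
  assume M: "M \<in> carrier_mat n n \<and>
      (\<forall>j<n. T (b j) = (\<Oplus>\<^bsub>W\<^esub> i\<in>{..<n}. M $$ (i, j) \<odot>\<^bsub>W\<^esub> c i))"
    and M': "M' \<in> carrier_mat n n \<and>
      (\<forall>j<n. T (b j) = (\<Oplus>\<^bsub>W\<^esub> i\<in>{..<n}. M' $$ (i, j) \<odot>\<^bsub>W\<^esub> c i))"
  \<comment> \<open>Columns are cut down to extensional functions so that uniqueness of coordinates
    applies; entries with row index beyond \<open>n\<close> are unspecified.\<close>
  have col: "T (b j) = (\<Oplus>\<^bsub>W\<^esub> i\<in>{..<n}. restrict (\<lambda>i. N $$ (i, j)) {..<n} i \<odot>\<^bsub>W\<^esub> c i)"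
    if "j < n" and "\<forall>j<n. T (b j) = (\<Oplus>\<^bsub>W\<^esub> i\<in>{..<n}. N $$ (i, j) \<odot>\<^bsub>W\<^esub> c i)" for N j
  proof -
    have "(\<Oplus>\<^bsub>W\<^esub> i\<in>{..<n}. restrict (\<lambda>i. N $$ (i, j)) {..<n} i \<odot>\<^bsub>W\<^esub> c i) =
        (\<Oplus>\<^bsub>W\<^esub> i\<in>{..<n}. N $$ (i, j) \<odot>\<^bsub>W\<^esub> c i)"
      by (rule W.finsum_cong') (use indexed_basis_closed[OF assms(1,2)] in auto)
    with that show ?thesis by simp
  qed
  have "restrict (\<lambda>i. M $$ (i, j)) {..<n} = restrict (\<lambda>i. M' $$ (i, j)) {..<n}"
    if j: "j < n" for j
    using indexed_basis_ex1_coords[OF assms(1,2) assms(3)[OF j]]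
    by (rule ex1_unique)
      (use M M' in \<open>auto intro!: col[OF j] simp del: restrict_apply\<close>)
  then have "M $$ (i, j) = M' $$ (i, j)" if "i < n" "j < n" for i j
    using that fun_cong[of "restrict (\<lambda>i. M $$ (i, j)) {..<n}" _ i] by fastforce
  with conjunct1[OF M] conjunct1[OF M'] show "M = M'"
    by (intro eq_matI) (simp_all only: carrier_matD)
qed

lemma map_matrix:
  fixes W :: "(complex, 'e) module"
  assumes "vectorspace class_ring W" and "indexed_basis W n c"
    and "\<And>j. j < n \<Longrightarrow> T (b j) \<in> carrier W"
  shows map_matrix_carrier: "map_matrix n W b c T \<in> carrier_mat n n"
    and map_matrix_column: "j < n \<Longrightarrow>
      T (b j) = (\<Oplus>\<^bsub>W\<^esub> i\<in>{..<n}. map_matrix n W b c T $$ (i, j) \<odot>\<^bsub>W\<^esub> c i)"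
proof -
  have "map_matrix n W b c T \<in> carrier_mat n n \<and>
      (\<forall>j<n. T (b j) = (\<Oplus>\<^bsub>W\<^esub> i\<in>{..<n}. map_matrix n W b c T $$ (i, j) \<odot>\<^bsub>W\<^esub> c i))"
    unfolding map_matrix_def by (rule theI'[OF map_matrix_ex1[where T = T and b = b, OF assms]])
  then show "map_matrix n W b c T \<in> carrier_mat n n"
    and "j < n \<Longrightarrow> T (b j) = (\<Oplus>\<^bsub>W\<^esub> i\<in>{..<n}. map_matrix n W b c T $$ (i, j) \<odot>\<^bsub>W\<^esub> c i)"
    by simp_all
qed

section \<open>Expansion of forms and linear maps over finite sums\<close>

lemma form_finsum_left:
  fixes V :: "(complex, 'e) module"
  assumes "vectorspace class_ring V" and h: "nondegenerate_hermitian_form V h"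
    and "finite I" and "\<And>i. i \<in> I \<Longrightarrow> x i \<in> carrier V" and "w \<in> carrier V"
  shows "h (\<Oplus>\<^bsub>V\<^esub> i\<in>I. a i \<odot>\<^bsub>V\<^esub> x i) w = (\<Sum>i\<in>I. a i * h (x i) w)"
  using assms(3,4)
proof (induction I rule: finite_induct)
  interpret V: vectorspace class_ring V by fact
  case empty
  \<comment> \<open>The zero vector is written as \<open>0\<close> times \<open>w\<close>, so that
    homogeneity in the first argument makes the form vanish on the empty sum.\<close>
  have "h (0 \<odot>\<^bsub>V\<^esub> w) w = 0 * h w w"
    using h assms(5) unfolding nondegenerate_hermitian_form_def by blast
  moreover have "0 \<odot>\<^bsub>V\<^esub> w = \<zero>\<^bsub>V\<^esub>"
    using V.lmult_0[OF assms(5)] by simp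
  ultimately show ?case by simp
next
  interpret V: vectorspace class_ring V by fact
  case (insert j I)
  have sm: "a i \<odot>\<^bsub>V\<^esub> x i \<in> carrier V" if "i \<in> insert j I" for i
    using V.smult_closed[of "a i" "x i"] insert.prems[OF that] by simp
  have fs: "(\<Oplus>\<^bsub>V\<^esub> i\<in>I. a i \<odot>\<^bsub>V\<^esub> x i) \<in> carrier V"
    using sm by (intro V.finsum_closed) auto
  have "(\<Oplus>\<^bsub>V\<^esub> i\<in>insert j I. a i \<odot>\<^bsub>V\<^esub> x i) =
      a j \<odot>\<^bsub>V\<^esub> x j \<oplus>\<^bsub>V\<^esub> (\<Oplus>\<^bsub>V\<^esub> i\<in>I. a i \<odot>\<^bsub>V\<^esub> x i)"
    using insert.hyps sm by (intro V.finsum_insert) auto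
  moreover have "h (a j \<odot>\<^bsub>V\<^esub> x j \<oplus>\<^bsub>V\<^esub> (\<Oplus>\<^bsub>V\<^esub> i\<in>I. a i \<odot>\<^bsub>V\<^esub> x i)) w =
      h (a j \<odot>\<^bsub>V\<^esub> x j) w + h (\<Oplus>\<^bsub>V\<^esub> i\<in>I. a i \<odot>\<^bsub>V\<^esub> x i) w"
    using h sm fs assms(5) unfolding nondegenerate_hermitian_form_def by blast
  moreover have "h (a j \<odot>\<^bsub>V\<^esub> x j) w = a j * h (x j) w"
    using h insert.prems assms(5) unfolding nondegenerate_hermitian_form_def by blast
  ultimately show ?case
    using insert by simp
qed

text \<open>The second argument is reduced to the first by Hermitian symmetry; the conjugation this
  introduces falls on the coefficients \<open>c k\<close>.\<close>

lemma form_finsum: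
  fixes V :: "(complex, 'e) module"
  assumes "vectorspace class_ring V" and h: "nondegenerate_hermitian_form V h"
    and I: "finite I" "\<And>i. i \<in> I \<Longrightarrow> x i \<in> carrier V"
    and K: "finite K" "\<And>k. k \<in> K \<Longrightarrow> y k \<in> carrier V"
  shows "h (\<Oplus>\<^bsub>V\<^esub> i\<in>I. a i \<odot>\<^bsub>V\<^esub> x i) (\<Oplus>\<^bsub>V\<^esub> k\<in>K. c k \<odot>\<^bsub>V\<^esub> y k) =
    (\<Sum>i\<in>I. \<Sum>k\<in>K. a i * cnj (c k) * h (x i) (y k))"
proof -
  interpret V: vectorspace class_ring V by fact
  let ?w = "\<Oplus>\<^bsub>V\<^esub> k\<in>K. c k \<odot>\<^bsub>V\<^esub> y k"
  have herm: "h u v = cnj (h v u)" if "u \<in> carrier V" "v \<in> carrier V" for u v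
    using h that unfolding nondegenerate_hermitian_form_def by blast
  have w: "?w \<in> carrier V"
    using V.smult_closed K(2) by (intro V.finsum_closed) auto
  have right: "h u ?w = (\<Sum>k\<in>K. cnj (c k) * h u (y k))" if u: "u \<in> carrier V" for u
  proof -
    have "h u ?w = cnj (\<Sum>k\<in>K. c k * h (y k) u)"
      using herm[OF u w] form_finsum_left[OF assms(1) h K u] by simp
    also have "\<dots> = (\<Sum>k\<in>K. cnj (c k) * h u (y k))"
      using herm[OF u K(2)] by simp
    finally show ?thesis .
  qed
  show ?thesis
    using form_finsum_left[OF assms(1) h I w] right[OF I(2)]
    by (simp add: sum_distrib_left mult.assoc)
qed

lemma linear_map_finsum:
  fixes V :: "(complex, 'e) module"
  assumes "linear_map class_ring V W T" and "finite I" and "\<And>i. i \<in> I \<Longrightarrow> x i \<in> carrier V"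
  shows "T (\<Oplus>\<^bsub>V\<^esub> i\<in>I. a i \<odot>\<^bsub>V\<^esub> x i) = (\<Oplus>\<^bsub>W\<^esub> i\<in>I. a i \<odot>\<^bsub>W\<^esub> T (x i))"
proof -
  interpret V: vectorspace class_ring V
    using assms(1) by (simp add: linear_map_def)
  interpret W: vectorspace class_ring W
    using assms(1) by (simp add: linear_map_def)
  interpret T: linear_map class_ring V W T by fact
  show ?thesis
    using assms(2,3)
  proof (induction I rule: finite_induct)
    case empty
    then show ?case by simp
  next
    case (insert j I)
    have V: "a i \<odot>\<^bsub>V\<^esub> x i \<in> carrier V" and W: "a i \<odot>\<^bsub>W\<^esub> T (x i) \<in> carrier W"
      if "i \<in> insert j I" for i
      using V.smult_closed[of "a i" "x i"] W.smult_closed[of "a i" "T (x i)"]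
        insert.prems[OF that] T.T_im by auto
    have "(\<Oplus>\<^bsub>V\<^esub> i\<in>insert j I. a i \<odot>\<^bsub>V\<^esub> x i) =
        a j \<odot>\<^bsub>V\<^esub> x j \<oplus>\<^bsub>V\<^esub> (\<Oplus>\<^bsub>V\<^esub> i\<in>I. a i \<odot>\<^bsub>V\<^esub> x i)"
      using insert.hyps V by (intro V.finsum_insert) auto
    moreover have "(\<Oplus>\<^bsub>W\<^esub> i\<in>insert j I. a i \<odot>\<^bsub>W\<^esub> T (x i)) =
        a j \<odot>\<^bsub>W\<^esub> T (x j) \<oplus>\<^bsub>W\<^esub> (\<Oplus>\<^bsub>W\<^esub> i\<in>I. a i \<odot>\<^bsub>W\<^esub> T (x i))"
      using insert.hyps W by (intro W.finsum_insert) auto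
    moreover have "(\<Oplus>\<^bsub>V\<^esub> i\<in>I. a i \<odot>\<^bsub>V\<^esub> x i) \<in> carrier V"
      using V by (intro V.finsum_closed) auto
    ultimately show ?case
      using insert V T.T_add T.T_smult[of "a j" "x j"] by simp
  qed
qed

section \<open>Matrix form of the isometry condition\<close>

lemma mat_adjoint_square:
  fixes A :: "complex mat"
  assumes "A \<in> carrier_mat n n"
  shows mat_adjoint_square_carrier: "mat_adjoint A \<in> carrier_mat n n"
    and mat_adjoint_square_index:
      "i < n \<Longrightarrow> j < n \<Longrightarrow> mat_adjoint A $$ (i, j) = cnj (A $$ (j, i))"
  using assms by (auto simp: mat_adjoint_def mat_of_rows_def)

text \<open>The double sum is arranged to match \<open>form_finsum\<close>: the unconjugated column
  \<open>i\<close> belongs to the first argument of the form and the conjugated column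
  \<open>j\<close> to the second. This is why the entry is taken at \<open>(j, i)\<close>.\<close>

lemma index_adjoint_mult_transpose_mult:
  fixes A G :: "complex mat"
  assumes A: "A \<in> carrier_mat n n" and G: "G \<in> carrier_mat n n" and "i < n" and "j < n"
  shows "(mat_adjoint A * transpose_mat G * A) $$ (j, i) =
    (\<Sum>k<n. \<Sum>l<n. A $$ (k, i) * cnj (A $$ (l, j)) * G $$ (k, l))"
proof -
  have "(mat_adjoint A * transpose_mat G * A) $$ (j, i) =
      (\<Sum>l<n. \<Sum>k<n. A $$ (k, i) * cnj (A $$ (l, j)) * G $$ (k, l))"
    using assms mat_adjoint_square_carrier[OF A]
    by (simp add: scalar_prod_def lessThan_atLeast0 sum_distrib_left
        mat_adjoint_square_index[OF A] mult_ac)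
  also have "\<dots> = (\<Sum>k<n. \<Sum>l<n. A $$ (k, i) * cnj (A $$ (l, j)) * G $$ (k, l))"
    by (rule sum.swap)
  finally show ?thesis .
qed

text \<open>Both sides of the isometry condition are sesquilinear in \<open>u\<close> and
  \<open>v\<close>, so it can be tested on basis vectors, where it is the matrix equation read entry
  by entry. Source and target have separate spaces, bases and forms, as needed for the fibres at two
  parameters of a path.\<close>

lemma isometry_iff_matrix:
  fixes V W :: "(complex, 'e) module"
  assumes V: "vectorspace class_ring V" "indexed_basis V n b" "nondegenerate_hermitian_form V h"
    and W: "vectorspace class_ring W" "indexed_basis W n c" "nondegenerate_hermitian_form W k"
    and T: "linear_map class_ring V W T"
  shows "(\<forall>u\<in>carrier V. \<forall>v\<in>carrier V. h u v = k (T u) (T v)) \<longleftrightarrow>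
    transpose_mat (mat n n (\<lambda>(i, j). h (b i) (b j))) =
      mat_adjoint (map_matrix n W b c T) * transpose_mat (mat n n (\<lambda>(i, j). k (c i) (c j))) *
      map_matrix n W b c T"
    (is "?isometry \<longleftrightarrow> ?G = ?P")
proof -
  interpret T: linear_map class_ring V W T by fact
  let ?H = "map_matrix n W b c T"
  have b: "b i \<in> carrier V" if "i < n" for i
    using indexed_basis_closed[OF V(1,2) that] .
  have c: "c i \<in> carrier W" if "i < n" for i
    using indexed_basis_closed[OF W(1,2) that] .
  have Tb: "T (b i) \<in> carrier W" if "i < n" for i
    using T.T_im[OF b[OF that]] .
  have H: "?H \<in> carrier_mat n n"
    using map_matrix_carrier[OF W(1,2)] Tb .
  have col: "T (b j) = (\<Oplus>\<^bsub>W\<^esub> i\<in>{..<n}. ?H $$ (i, j) \<odot>\<^bsub>W\<^esub> c i)" if "j < n" for j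
    using map_matrix_column[where T = T and b = b, OF W(1,2)] Tb that by blast
  \<comment> \<open>The right-hand matrix is the transposed Gram matrix of the images
    \<open>T (b i)\<close>.\<close>
  have P: "?P $$ (j, i) = k (T (b i)) (T (b j))" if "i < n" "j < n" for i j
  proof -
    have "k (T (b i)) (T (b j)) =
        (\<Sum>p<n. \<Sum>q<n. ?H $$ (p, i) * cnj (?H $$ (q, j)) * k (c p) (c q))"
      unfolding col[OF that(1)] col[OF that(2)]
      using c by (intro form_finsum[OF W(1,3)]) auto
    also have "\<dots> = ?P $$ (j, i)"
      using index_adjoint_mult_transpose_mult[OF H mat_carrier that] by simp
    finally show ?thesis ..
  qed
  have P_dim: "?P \<in> carrier_mat n n"
    using H mat_adjoint_square_carrier[OF H]
    by (intro mult_carrier_mat[of _ n n _ n]) auto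
  have on_basis: "?G = ?P \<longleftrightarrow> (\<forall>i<n. \<forall>j<n. h (b i) (b j) = k (T (b i)) (T (b j)))"
  proof
    assume eq: "?G = ?P"
    show "\<forall>i<n. \<forall>j<n. h (b i) (b j) = k (T (b i)) (T (b j))"
    proof (intro allI impI)
      fix i j assume ij: "i < n" "j < n"
      have "?G $$ (j, i) = ?P $$ (j, i)"
        using eq by (rule arg_cong)
      with P[OF ij] ij show "h (b i) (b j) = k (T (b i)) (T (b j))"
        by simp
    qed
  next
    assume "\<forall>i<n. \<forall>j<n. h (b i) (b j) = k (T (b i)) (T (b j))"
    then have "?G $$ (j, i) = ?P $$ (j, i)" if "j < n" "i < n" for i j
      using that P[OF that(2,1)] by simp
    then show "?G = ?P"
      using P_dim by (intro eq_matI[of ?P ?G]) (simp_all only: carrier_matD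
          index_transpose_mat dim_row_mat dim_col_mat)
  qed
  have "?isometry \<longleftrightarrow> (\<forall>i<n. \<forall>j<n. h (b i) (b j) = k (T (b i)) (T (b j)))"
  proof
    assume ?isometry
    then show "\<forall>i<n. \<forall>j<n. h (b i) (b j) = k (T (b i)) (T (b j))"
      using b by blast
  next
    assume eq: "\<forall>i<n. \<forall>j<n. h (b i) (b j) = k (T (b i)) (T (b j))"
    show ?isometry
    proof (intro ballI)
      fix u v assume u: "u \<in> carrier V" and v: "v \<in> carrier V"
      obtain x where x: "u = (\<Oplus>\<^bsub>V\<^esub> i\<in>{..<n}. x i \<odot>\<^bsub>V\<^esub> b i)"
        using indexed_basis_coords[OF V(1,2) u] .
      obtain y where y: "v = (\<Oplus>\<^bsub>V\<^esub> i\<in>{..<n}. y i \<odot>\<^bsub>V\<^esub> b i)"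
        using indexed_basis_coords[OF V(1,2) v] .
      \<comment> \<open>The form \<open>h\<close> is expanded in coordinates, its values on basis
        pairs are replaced by those of \<open>k\<close>, and the sum is folded back using linearity
        of \<open>T\<close>.\<close>
      have "h u v = (\<Sum>i<n. \<Sum>j<n. x i * cnj (y j) * h (b i) (b j))"
        unfolding x y using b by (intro form_finsum[OF V(1,3)]) auto
      also have "\<dots> = (\<Sum>i<n. \<Sum>j<n. x i * cnj (y j) * k (T (b i)) (T (b j)))"
        using eq by simp
      also have "\<dots> = k (\<Oplus>\<^bsub>W\<^esub> i\<in>{..<n}. x i \<odot>\<^bsub>W\<^esub> T (b i)) (\<Oplus>\<^bsub>W\<^esub> i\<in>{..<n}. y i \<odot>\<^bsub>W\<^esub> T (b i))"
        using Tb by (intro form_finsum[OF W(1,3), symmetric]) auto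
      also have "\<dots> = k (T u) (T v)"
        unfolding x y using b
        by (subst (1 2) linear_map_finsum[OF T finite_lessThan]) auto
      finally show "h u v = k (T u) (T v)" .
    qed
  qed
  with on_basis show ?thesis by simp
qed

section \<open>Consistency along paths\<close>

theorem proposition4p1:
  fixes E :: "'e topology" and p :: "'e \<Rightarrow> 'b" and B :: "'b topology"
    and F :: "'b \<Rightarrow> (complex, 'e) module" and n :: nat
    and g :: "'b \<Rightarrow> 'e \<Rightarrow> 'e \<Rightarrow> complex"
    and L :: "real set \<Rightarrow> (real \<Rightarrow> 'b) \<Rightarrow> real \<Rightarrow> real \<Rightarrow> 'e \<Rightarrow> 'e"
    and e :: "real set \<Rightarrow> (real \<Rightarrow> 'b) \<Rightarrow> real \<Rightarrow> nat \<Rightarrow> 'e"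
  assumes "complex_vector_bundle E p B F n"
    and "hermitian_bundle_metric B F g"
    and "linear_transport B F L"
    and "\<And>J \<gamma> s. is_path B J \<gamma> \<Longrightarrow> s \<in> J \<Longrightarrow> indexed_basis (F (\<gamma> s)) n (e J \<gamma> s)"
  shows "(consistent B F g L \<longleftrightarrow>
      (\<forall>J \<gamma>. is_path B J \<gamma> \<longrightarrow> (\<forall>s\<in>J. \<forall>t\<in>J.
        transpose_mat (metric_matrix n g (e J \<gamma>) \<gamma> s) =
          mat_adjoint (transport_matrix n F L (e J \<gamma>) J \<gamma> t s) *
          transpose_mat (metric_matrix n g (e J \<gamma>) \<gamma> t) *
          transport_matrix n F L (e J \<gamma>) J \<gamma> t s))) \<and>
    (\<forall>J \<gamma>. is_path B J \<gamma> \<longrightarrow>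
      (consistent_along F g L J \<gamma> \<longleftrightarrow> (\<forall>s\<in>J. \<forall>t\<in>J.
        transpose_mat (metric_matrix n g (e J \<gamma>) \<gamma> s) =
          mat_adjoint (transport_matrix n F L (e J \<gamma>) J \<gamma> t s) *
          transpose_mat (metric_matrix n g (e J \<gamma>) \<gamma> t) *
          transport_matrix n F L (e J \<gamma>) J \<gamma> t s)))"
proof -
  interpret complex_vector_bundle E p B F n by fact
  have along: "consistent_along F g L J \<gamma> \<longleftrightarrow> (\<forall>s\<in>J. \<forall>t\<in>J.
      transpose_mat (metric_matrix n g (e J \<gamma>) \<gamma> s) =
        mat_adjoint (transport_matrix n F L (e J \<gamma>) J \<gamma> t s) *
        transpose_mat (metric_matrix n g (e J \<gamma>) \<gamma> t) *
        transport_matrix n F L (e J \<gamma>) J \<gamma> t s)"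
    if path: "is_path B J \<gamma>" for J \<gamma>
  proof -
    \<comment> \<open>The fibre and metric hypotheses hold only over points of
      \<open>topspace B\<close>, so the path must be shown to stay there.\<close>
    have base: "\<gamma> s \<in> topspace B" if "s \<in> J" for s
      using path that continuous_map_image_subset_topspace[of "top_of_set J" B \<gamma>]
      by (auto simp: is_path_def)
    have "(\<forall>u\<in>carrier (F (\<gamma> s)). \<forall>v\<in>carrier (F (\<gamma> s)).
          g (\<gamma> s) u v = g (\<gamma> t) (L J \<gamma> s t u) (L J \<gamma> s t v)) \<longleftrightarrow>
        transpose_mat (metric_matrix n g (e J \<gamma>) \<gamma> s) =
          mat_adjoint (transport_matrix n F L (e J \<gamma>) J \<gamma> t s) *
          transpose_mat (metric_matrix n g (e J \<gamma>) \<gamma> t) *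
          transport_matrix n F L (e J \<gamma>) J \<gamma> t s"
      if "s \<in> J" "t \<in> J" for s t
      \<comment> \<open>Unfolding exposes an instance of \<open>isometry_iff_matrix\<close> for the
        map \<open>L J \<gamma> s t\<close> between the fibres over \<open>\<gamma> s\<close> and
        \<open>\<gamma> t\<close>, with the bases chosen at the parameters \<open>s\<close> and
        \<open>t\<close>.\<close>
      unfolding metric_matrix_def transport_matrix_def
      using that path assms(2-4) base fibre_vectorspace
      by (intro isometry_iff_matrix)
        (auto simp: hermitian_bundle_metric_def linear_transport_def)
    then show ?thesis
      unfolding consistent_along_def by simp
  qed
  then show ?thesis
    unfolding consistent_def by simp
qed

end
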